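(* Let $M$ be a real differentiable manifold, let $p,q\ge 0$ be integers, and for all $x,y\in M$ let $L^{p,q}_{x\to y}:T^{p,q}_x(M)\to T^{p,q}_y(M)$ be a linear map. Then the conditions $$L^{p,q}_{y\to z}\circ L^{p,q}_{x\to y}=L^{p,q}_{x\to z}\quad\text{and}\quad L^{p,q}_{x\to x}=\mathrm{id}\qquad\text{for all }x,y,z\in M$$ hold if and only if there exist a real vector space $V$ and linear isomorphisms $L^{p,q}_x:T^{p,q}_x(M)\to V$, $x\in M$, such that $$L^{p,q}_{x\to y}=\bigl(L^{p,q}_y\bigr)^{-1}\circ L^{p,q}_x\qquad\text{for all }x,y\in M.$$
   Context: $T^{p,q}_x(M)$ denotes the space of tensors of type $(p,q)$ at $x\in M$, with $T^{1,0}_x(M)=T_x(M)$ the tangent space and $T^{0,1}_x(M)=T_x^*(M)$ the cotangent space. $M$ is finite-dimensional of dimension $n$. No continuity or smoothness in $x,y$ is assumed. *)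

theory Defs
  imports "HOL-Analysis.Analysis" "HOL-Library.Function_Algebras" "HOL-Library.Extended_Nat"
begin

text \<open>
  Vector spaces that depend on a point of the manifold are represented as linear subspaces
  (in the sense of \<^const>\<open>subspace\<close>) of spaces of functions with pointwise operations.
\<close>

instantiation "fun" :: (type, real_vector) real_vector
begin

definition "scaleR c f = (\<lambda>x. c *\<^sub>R f x)"

instance
  by standard (simp_all add: scaleR_fun_def fun_eq_iff scaleR_add_right scaleR_add_left)

end

text \<open>Nothing is required of \<open>f\<close> outside \<open>S\<close>.\<close>

definition linear_map_on ::
  "'v::real_vector set \<Rightarrow> 'w::real_vector set \<Rightarrow> ('v \<Rightarrow> 'w) \<Rightarrow> bool" where
  "linear_map_on S T f \<longleftrightarrow>
     f \<in> S \<rightarrow> T \<and>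
     (\<forall>u\<in>S. \<forall>v\<in>S. f (u + v) = f u + f v) \<and>
     (\<forall>c. \<forall>u\<in>S. f (c *\<^sub>R u) = c *\<^sub>R f u)"

definition linear_iso_on ::
  "'v::real_vector set \<Rightarrow> 'w::real_vector set \<Rightarrow> ('v \<Rightarrow> 'w) \<Rightarrow> bool" where
  "linear_iso_on S T f \<longleftrightarrow> linear_map_on S T f \<and> bij_betw f S T"


text \<open>
  Points of \<open>\<real>\<^sup>n\<close> are the elements of \<open>topspace (Euclidean_space n)\<close>: functions
  \<^typ>\<open>nat \<Rightarrow> real\<close> that vanish at all indices \<open>\<ge> n\<close>.  This keeps the dimension a term and
  includes \<open>n = 0\<close>.
\<close>

definition partial_deriv :: "nat \<Rightarrow> ((nat \<Rightarrow> real) \<Rightarrow> real) \<Rightarrow> (nat \<Rightarrow> real) \<Rightarrow> real" where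
  "partial_deriv j f u = deriv (\<lambda>s. f (u(j := s))) (u j)"

text \<open>\<open>k\<close> times continuously differentiable on an open set \<open>W\<close> of \<open>\<real>\<^sup>n\<close>.\<close>

fun Ck_on :: "nat \<Rightarrow> nat \<Rightarrow> (nat \<Rightarrow> real) set \<Rightarrow> ((nat \<Rightarrow> real) \<Rightarrow> real) \<Rightarrow> bool" where
  "Ck_on 0 n W f \<longleftrightarrow> continuous_map (subtopology (Euclidean_space n) W) euclideanreal f"
| "Ck_on (Suc k) n W f \<longleftrightarrow>
     continuous_map (subtopology (Euclidean_space n) W) euclideanreal f \<and>
     (\<forall>j<n. (\<forall>u\<in>W. (\<lambda>s. f (u(j := s))) field_differentiable at (u j)) \<and>
            Ck_on k n W (partial_deriv j f))"


text \<open>A chart is a pair of its domain and its coordinate map.\<close>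

type_synonym 'a chart = "'a set \<times> ('a \<Rightarrow> nat \<Rightarrow> real)"

definition is_chart :: "nat \<Rightarrow> 'a topology \<Rightarrow> 'a chart \<Rightarrow> bool" where
  "is_chart n M c \<longleftrightarrow>
     openin M (fst c) \<and>
     openin (Euclidean_space n) (snd c ` fst c) \<and>
     homeomorphic_map (subtopology M (fst c))
       (subtopology (Euclidean_space n) (snd c ` fst c)) (snd c)"

definition transition :: "'a chart \<Rightarrow> 'a chart \<Rightarrow> (nat \<Rightarrow> real) \<Rightarrow> nat \<Rightarrow> real" where
  "transition c d u = snd d (inv_into (fst c) (snd c) u)"

text \<open>
  \<open>M\<close> with atlas \<open>A\<close> is a manifold of dimension \<open>n\<close> and class \<open>C\<^sup>r\<close>, where \<open>1 \<le> r \<le> \<infinity>\<close>.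
  The atlas may or may not be maximal.  Second countability is not part of the definition.
\<close>

definition differentiable_manifold ::
  "enat \<Rightarrow> nat \<Rightarrow> 'a topology \<Rightarrow> 'a chart set \<Rightarrow> bool" where
  "differentiable_manifold r n M A \<longleftrightarrow>
     1 \<le> r \<and>
     Hausdorff_space M \<and>
     (\<forall>c\<in>A. is_chart n M c) \<and>
     (\<Union>c\<in>A. fst c) = topspace M \<and>
     (\<forall>c\<in>A. \<forall>d\<in>A. \<forall>i<n. \<forall>k. enat k \<le> r \<longrightarrow>
        Ck_on k n (snd c ` (fst c \<inter> fst d)) (\<lambda>u. transition c d u i))"


text \<open>
  A tangent vector at \<open>x\<close> assigns to every chart around \<open>x\<close> a vector of components in \<open>\<real>\<^sup>n\<close>,
  subject to the contravariant transformation law.  It is set to \<open>0\<close> on all other charts, so that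
  equality of tangent vectors is equality of functions.
\<close>

type_synonym 'a tangent_vector = "'a chart \<Rightarrow> nat \<Rightarrow> real"

definition tangent_space :: "nat \<Rightarrow> 'a chart set \<Rightarrow> 'a \<Rightarrow> 'a tangent_vector set" where
  "tangent_space n A x =
     {v. (\<forall>c. \<not> (c \<in> A \<and> x \<in> fst c) \<longrightarrow> v c = 0) \<and>
         (\<forall>c\<in>A. x \<in> fst c \<longrightarrow> v c \<in> topspace (Euclidean_space n)) \<and>
         (\<forall>c\<in>A. \<forall>d\<in>A. x \<in> fst c \<and> x \<in> fst d \<longrightarrow>
            (\<forall>i<n. v d i =
               (\<Sum>j<n. partial_deriv j (\<lambda>u. transition c d u i) (snd c x) * v c j)))}"

text \<open>Linear functionals on \<open>S\<close>, set to \<open>0\<close> outside \<open>S\<close>.\<close>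

definition dual_space :: "'v::real_vector set \<Rightarrow> ('v \<Rightarrow> real) set" where
  "dual_space S = {a. linear_map_on S UNIV a \<and> (\<forall>v. v \<notin> S \<longrightarrow> a v = 0)}"

text \<open>
  Tensors of type \<open>(p, q)\<close> over \<open>S\<close>: real multilinear maps in \<open>p\<close> covectors and \<open>q\<close> vectors, set to
  \<open>0\<close> on tuples that do not consist of such arguments.  Tuples are extensional functions on
  \<open>{..<p}\<close> and \<open>{..<q}\<close>.  Type \<open>(1, 0)\<close> gives the bidual of \<open>S\<close>, that is, \<open>S\<close> itself in finite
  dimension.
\<close>

type_synonym 'v tensor = "(nat \<Rightarrow> 'v \<Rightarrow> real) \<Rightarrow> (nat \<Rightarrow> 'v) \<Rightarrow> real"

definition tensor_space :: "nat \<Rightarrow> nat \<Rightarrow> 'v::real_vector set \<Rightarrow> 'v tensor set" where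
  "tensor_space p q S =
     {t. (\<forall>a v. \<not> (a \<in> {..<p} \<rightarrow>\<^sub>E dual_space S \<and> v \<in> {..<q} \<rightarrow>\<^sub>E S) \<longrightarrow> t a v = 0) \<and>
         (\<forall>a \<in> {..<p} \<rightarrow>\<^sub>E dual_space S. \<forall>v \<in> {..<q} \<rightarrow>\<^sub>E S.
            (\<forall>i<p. linear_map_on (dual_space S) UNIV (\<lambda>b. t (a(i := b)) v)) \<and>
            (\<forall>i<q. linear_map_on S UNIV (\<lambda>w. t a (v(i := w)))))}"

abbreviation tensors_at ::
  "nat \<Rightarrow> nat \<Rightarrow> nat \<Rightarrow> 'a chart set \<Rightarrow> 'a \<Rightarrow> 'a tangent_vector tensor set" where
  "tensors_at p q n A x \<equiv> tensor_space p q (tangent_space n A x)"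


text \<open>
  The maps \<open>L x y : T x \<rightarrow> T y\<close> for \<open>x, y \<in> X\<close> are of the form \<open>(F y)\<inverse> \<circ> F x\<close> with linear
  isomorphisms \<open>F x : T x \<rightarrow> V\<close> onto a real vector space \<open>V\<close>.
\<close>

definition factors_through ::
  "'a set \<Rightarrow> ('a \<Rightarrow> 'u::real_vector set) \<Rightarrow> ('a \<Rightarrow> 'a \<Rightarrow> 'u \<Rightarrow> 'u) \<Rightarrow>
   'v::real_vector set \<Rightarrow> ('a \<Rightarrow> 'u \<Rightarrow> 'v) \<Rightarrow> bool" where
  "factors_through X T L V F \<longleftrightarrow>
     subspace V \<and>
     (\<forall>x\<in>X. linear_iso_on (T x) V (F x)) \<and>
     (\<forall>x\<in>X. \<forall>y\<in>X. \<forall>t\<in>T x. L x y t = inv_into (T y) (F y) (F x t))"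

definition transport_law ::
  "'a set \<Rightarrow> ('a \<Rightarrow> 'u::real_vector set) \<Rightarrow> ('a \<Rightarrow> 'a \<Rightarrow> 'u \<Rightarrow> 'u) \<Rightarrow> bool" where
  "transport_law X T L \<longleftrightarrow>
     (\<forall>x\<in>X. \<forall>y\<in>X. \<forall>z\<in>X. \<forall>t\<in>T x. L y z (L x y t) = L x z t) \<and>
     (\<forall>x\<in>X. \<forall>t\<in>T x. L x x t = t)"

end

theory Submission
  imports Defs
begin

text \<open>
  The argument is a cancellation argument, valid for any family of vector spaces \<open>T x\<close> with linear
  maps \<open>L x y : T x \<rightarrow> T y\<close>.  It applies here because the tensors at a point form a vector space
  (\<open>subspace_tensor_space\<close>).

  If \<open>L x y = (F y)\<inverse> \<circ> F x\<close>, then the inner factors in \<open>L y z \<circ> L x y\<close> cancel, which gives the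
  transport law (\<open>factors_through_imp_transport_law\<close>).  Conversely, if the transport law holds,
  every \<open>L x y\<close> is invertible with inverse \<open>L y x\<close>.  Hence one may fix a base point \<open>b\<close> and take \<open>V = T b\<close> and \<open>F x = L x b\<close>: the law
  \<open>L y b \<circ> L x y = L x b\<close> is the required factorization
  (\<open>transport_law_imp_factors_through_base_point\<close>).  Without points there is no base point,
  and any vector space, such as \<open>{0}\<close>, serves as \<open>V\<close>.
\<close>

lemma factors_through_imp_transport_law:
  assumes "factors_through X T L V F"
  shows "transport_law X T L"
proof -
  have bij: "bij_betw (F x) (T x) V" if "x \<in> X" for x
    using assms that by (auto simp: factors_through_def linear_iso_on_def)
  have L: "L x y t = inv_into (T y) (F y) (F x t)" if "x \<in> X" "y \<in> X" "t \<in> T x" for x y t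
    using assms that by (auto simp: factors_through_def)
  have V: "F x t \<in> V" if "x \<in> X" "t \<in> T x" for x t
    using bij[OF that(1)] that(2) by (rule bij_betwE[rule_format])
  have in_T: "L x y t \<in> T y" if "x \<in> X" "y \<in> X" "t \<in> T x" for x y t
    using L[OF that] bij[OF that(2)] V[OF that(1,3)]
    by (metis bij_betw_imp_surj_on inv_into_into)
  have F_L: "F y (L x y t) = F x t" if "x \<in> X" "y \<in> X" "t \<in> T x" for x y t
    using L[OF that] bij_betw_inv_into_right[OF bij[OF that(2)] V[OF that(1,3)]] by simp
  show ?thesis
    unfolding transport_law_def
  proof (intro conjI ballI)
    fix x y z t
    assume "x \<in> X" "y \<in> X" "z \<in> X" "t \<in> T x"
    then show "L y z (L x y t) = L x z t"
      by (simp add: L[of y z] L[of x z] in_T F_L)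
  next
    fix x t
    assume "x \<in> X" "t \<in> T x"
    then show "L x x t = t"
      by (simp add: L bij_betw_inv_into_left[OF bij])
  qed
qed

lemma transport_law_imp_bij_betw:
  assumes "transport_law X T L"
    and "\<And>x y. x \<in> X \<Longrightarrow> y \<in> X \<Longrightarrow> L x y \<in> T x \<rightarrow> T y"
    and "x \<in> X" "y \<in> X"
  shows "bij_betw (L x y) (T x) (T y)"
  using assms by (intro bij_betwI[where g = "L y x"]) (auto simp: transport_law_def)

text \<open>
  Since \<open>L y b\<close> is injective and sends \<open>L x y t\<close> to \<open>L x b t\<close>, the vector \<open>L x y t\<close> is the only
  preimage of \<open>L x b t\<close>.  The common space is one of the given spaces, so it has their type.
\<close>

lemma transport_law_imp_factors_through_base_point:
  assumes law: "transport_law X T L"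
    and lin: "\<And>x y. x \<in> X \<Longrightarrow> y \<in> X \<Longrightarrow> linear_map_on (T x) (T y) (L x y)"
    and b: "b \<in> X" and "subspace (T b)"
  shows "factors_through X T L (T b) (\<lambda>x. L x b)"
proof -
  have maps: "L x y \<in> T x \<rightarrow> T y" if "x \<in> X" "y \<in> X" for x y
    using lin[OF that] by (simp add: linear_map_on_def)
  have bij: "bij_betw (L x b) (T x) (T b)" if "x \<in> X" for x
    using transport_law_imp_bij_betw[OF law maps that b] .
  have "L x y t = inv_into (T y) (L y b) (L x b t)" if "x \<in> X" "y \<in> X" "t \<in> T x" for x y t
  proof (rule inv_into_f_eq[symmetric])
    show "inj_on (L y b) (T y)"
      using bij[OF that(2)] by (rule bij_betw_imp_inj_on)
    show "L x y t \<in> T y"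
      using maps that by blast
    show "L y b (L x y t) = L x b t"
      using law that b by (simp add: transport_law_def)
  qed
  then show ?thesis
    unfolding factors_through_def linear_iso_on_def
    by (intro conjI ballI lin bij b \<open>subspace (T b)\<close>)
qed

lemma linear_map_on_zero: "linear_map_on S UNIV (\<lambda>x. 0)"
  by (simp add: linear_map_on_def)

lemma linear_map_on_add:
  assumes "linear_map_on S UNIV f" "linear_map_on S UNIV g"
  shows "linear_map_on S UNIV (\<lambda>x. f x + g x)"
  using assms by (simp add: linear_map_on_def algebra_simps)

lemma linear_map_on_scaleR:
  assumes "linear_map_on S UNIV f"
  shows "linear_map_on S UNIV (\<lambda>x. c *\<^sub>R f x)"
  using assms by (simp add: linear_map_on_def scaleR_add_right mult.commute)

text \<open>
  Both defining conditions, vanishing outside the admissible tuples and linearity in each argument,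
  are preserved by pointwise linear combinations.
\<close>

lemma subspace_tensor_space: "subspace (tensor_space p q S)"
proof (rule subspaceI)
  show "0 \<in> tensor_space p q S"
    by (simp add: tensor_space_def linear_map_on_zero)
next
  fix s t
  assume "s \<in> tensor_space p q S" "t \<in> tensor_space p q S"
  then show "s + t \<in> tensor_space p q S"
    unfolding tensor_space_def mem_Collect_eq plus_fun_apply
    by (intro conjI allI ballI impI linear_map_on_add) auto
next
  fix c t
  assume "t \<in> tensor_space p q S"
  then show "c *\<^sub>R t \<in> tensor_space p q S"
    unfolding tensor_space_def mem_Collect_eq scaleR_fun_def
    by (intro conjI allI ballI impI linear_map_on_scaleR) auto
qed

theorem proposition2p1:
  fixes r :: enat and n p q :: nat
    and M :: "'a topology" and A :: "'a chart set"
    and L :: "'a \<Rightarrow> 'a \<Rightarrow> 'a tangent_vector tensor \<Rightarrow> 'a tangent_vector tensor"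
  assumes "differentiable_manifold r n M A"
    and "\<And>x y. x \<in> topspace M \<Longrightarrow> y \<in> topspace M \<Longrightarrow>
           linear_map_on (tensors_at p q n A x) (tensors_at p q n A y) (L x y)"
  shows "(transport_law (topspace M) (tensors_at p q n A) L \<longleftrightarrow>
            (\<exists>(V :: 'a tangent_vector tensor set) F.
               factors_through (topspace M) (tensors_at p q n A) L V F)) \<and>
         (\<forall>(V :: 'v::real_vector set) F.
            factors_through (topspace M) (tensors_at p q n A) L V F \<longrightarrow>
            transport_law (topspace M) (tensors_at p q n A) L)"
proof (intro conjI iffI allI impI)
  let ?X = "topspace M" and ?T = "tensors_at p q n A"
  assume law: "transport_law ?X ?T L"
  show "\<exists>(V :: 'a tangent_vector tensor set) F. factors_through ?X ?T L V F"
  proof (cases "?X = {}")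
    case True
    then have "factors_through ?X ?T L {0 :: 'a tangent_vector tensor} F" for F
      unfolding factors_through_def by (simp add: subspace_def)
    then show ?thesis
      by (intro exI)
  next
    case False
    then obtain b where "b \<in> ?X"
      by blast
    then have "factors_through ?X ?T L (?T b) (\<lambda>x. L x b)"
      using transport_law_imp_factors_through_base_point[OF law assms(2) _ subspace_tensor_space]
      by simp
    then show ?thesis
      by (intro exI)
  qed
next
  assume "\<exists>(V :: 'a tangent_vector tensor set) F.
    factors_through (topspace M) (tensors_at p q n A) L V F"
  then show "transport_law (topspace M) (tensors_at p q n A) L"
    by (elim exE) (rule factors_through_imp_transport_law)
next
  fix V :: "'v set" and F
  assume "factors_through (topspace M) (tensors_at p q n A) L V F"
  then show "transport_law (topspace M) (tensors_at p q n A) L"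
    by (rule factors_through_imp_transport_law)
qed

end
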